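(* Let $F$ and $H$ be $q$-varieties and $\psi:F\to H$ a morphism. Then $\dim F=\dim\ker\psi+\dim\psi(F)$.
   Context: $p$ prime, $K$ algebraically closed of characteristic $p$, $q$ a power of $p$, $\mathbb{F}_q\subset K$. $K\{\tau\}$ is the ring of $\mathbb{F}_q$-linear polynomials $\sum a_iX^{q^i}$; $\Lambda_n$ the polynomials $\sum_{i=1}^nP_i(X_i)$ with $P_i\in K\{\tau\}$. A $q$-variety in $K^n$ is a set $\{x\in K^n: f(x)=0\ \forall f\in S\}$, $S\subset\Lambda_n$. A morphism $F\subset K^n\to H\subset K^m$ is a map $x\mapsto(f_1(x),\dots,f_m(x))$, $f_j\in\Lambda_n$ (its kernel and image are $q$-varieties). A $q$-variety is irreducible if it has no proper sub-$q$-variety of finite index. $\dim F$ is the maximal length $m$ of a chain $F_0\subsetneq\dots\subsetneq F_m\subset F$ of irreducible $q$-varieties. *)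

theory Defs
  imports
    "HOL-Computational_Algebra.Polynomial"
    "HOL-Algebra.Coset"
    "HOL-Library.Extended_Nat"
    "Jordan_Normal_Form.Matrix"
begin

text \<open>
  The field \<open>K\<close> is a type \<open>'a\<close> of class \<open>alg_closed_field\<close>, and \<open>K^n\<close> is \<open>carrier_vec n\<close>.
  The definitions below mention \<open>q\<close> as an arbitrary natural number; they have their intended
  meaning when \<open>q\<close> is a power \<open>p ^ e\<close> (\<open>e \<ge> 1\<close>) of the prime characteristic \<open>p\<close> of \<open>K\<close>.  The finite
  field \<open>{x. x ^ q = x}\<close> with \<open>q\<close> elements is then automatically contained in \<open>K\<close>.
\<close>

text \<open>\<open>K{\<tau>}\<close>: the polynomials \<open>\<Sum>\<^sub>i a\<^sub>i X^(q^i)\<close>.\<close>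

definition qlin_polys :: "nat \<Rightarrow> 'a::comm_ring_1 poly set" where
  "qlin_polys q = {P. \<exists>d a. P = (\<Sum>i\<le>d. Polynomial.monom (a i) (q ^ i))}"

text \<open>
  The polynomial \<open>P\<^sub>1(X\<^sub>1) + \<dots> + P\<^sub>n(X\<^sub>n)\<close> is represented by the tuple \<open>(P\<^sub>1, \<dots>, P\<^sub>n)\<close>.  As
  elements of \<open>K{\<tau>}\<close> have no constant term, the tuple is uniquely determined by the polynomial.
  Indices run from \<open>0\<close> to \<open>n - 1\<close>.
\<close>

definition Lambda :: "nat \<Rightarrow> nat \<Rightarrow> 'a::comm_ring_1 poly vec set" where
  "Lambda q n = {f \<in> carrier_vec n. \<forall>i<n. f $ i \<in> qlin_polys q}"

definition eval_Lambda :: "'a::comm_ring_1 poly vec \<Rightarrow> 'a vec \<Rightarrow> 'a" where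
  "eval_Lambda f x = (\<Sum>i<dim_vec f. poly (f $ i) (x $ i))"

definition q_variety :: "nat \<Rightarrow> nat \<Rightarrow> 'a::comm_ring_1 vec set \<Rightarrow> bool" where
  "q_variety q n F \<longleftrightarrow>
     (\<exists>S \<subseteq> Lambda q n. F = {x \<in> carrier_vec n. \<forall>f\<in>S. eval_Lambda f x = 0})"

definition q_morphism ::
  "nat \<Rightarrow> nat \<Rightarrow> 'a::comm_ring_1 vec set \<Rightarrow> nat \<Rightarrow> 'a vec set \<Rightarrow> ('a vec \<Rightarrow> 'a vec) \<Rightarrow> bool" where
  "q_morphism q n F m H \<psi> \<longleftrightarrow>
     (\<exists>f. (\<forall>j<m. f j \<in> Lambda q n) \<and>
          (\<forall>x\<in>F. \<psi> x = vec m (\<lambda>j. eval_Lambda (f j) x))) \<and>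
     \<psi> ` F \<subseteq> H"

definition add_grp :: "nat \<Rightarrow> 'a::ab_group_add vec set \<Rightarrow> 'a vec monoid" where
  "add_grp n F = (monoid_vec TYPE('a) n)\<lparr>carrier := F\<rparr>"

text \<open>The index of \<open>G\<close> in \<open>F\<close> is the index of additive groups.\<close>

definition q_irreducible :: "nat \<Rightarrow> nat \<Rightarrow> 'a::comm_ring_1 vec set \<Rightarrow> bool" where
  "q_irreducible q n F \<longleftrightarrow>
     q_variety q n F \<and>
     \<not> (\<exists>G. q_variety q n G \<and> G \<subset> F \<and> finite (rcosets\<^bsub>add_grp n F\<^esub> G))"

text \<open>
  The supremum is taken in \<open>enat\<close>, so that the dimension would be \<open>\<infinity>\<close> rather than
  an unspecified number if chains of unbounded length existed.
\<close>

definition q_dim :: "nat \<Rightarrow> nat \<Rightarrow> 'a::comm_ring_1 vec set \<Rightarrow> enat" where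
  "q_dim q n F = Sup {enat l | l. \<exists>C.
     (\<forall>i\<le>l. q_irreducible q n (C i) \<and> C i \<subseteq> F) \<and> (\<forall>i<l. C i \<subset> C (Suc i))}"

end

theory Submission
  imports Defs
begin

text \<open>
  Up to finite index, \<open>q\<close>-varieties form a modular lattice, and the dimension is its length.  By
  the descending chain condition every \<open>q\<close>-variety has an irreducible subvariety of finite index, so
  \<open>dim F\<close> is the supremum of the lengths of chains of arbitrary \<open>q\<close>-varieties in which each step
  has infinite index.  If \<open>V \<subset> V'\<close> has infinite index, then so does \<open>V \<inter> ker \<psi> \<subset> V' \<inter> ker \<psi>\<close>
  or \<open>\<psi>(V) \<subset> \<psi>(V')\<close>; conversely a chain in \<open>ker \<psi>\<close> can be continued by the preimages of a chain
  in \<open>\<psi>(F)\<close>.  That images are \<open>q\<close>-varieties is elimination theory over the left principal ideal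
  ring \<open>K{\<tau>}\<close>, whose nonzero elements are surjective on the algebraically closed field \<open>K\<close>.
\<close>

subsection \<open>Additive polynomials\<close>

text \<open>\<open>ty\<close> ties the type \<open>'a\<close> of \<open>K\<close> to the locale
  parameters, as neither \<open>q\<close> nor \<open>e\<close> mentions it.\<close>

locale frobenius_power =
  fixes q e :: nat and ty :: "'a::alg_closed_field itself"
  assumes prime_CHAR: "prime CHAR('a)" and q_eq: "q = CHAR('a) ^ e"
begin

lemma power_q_add: "(x + y :: 'a) ^ (q ^ i) = x ^ (q ^ i) + y ^ (q ^ i)"
  by (rule freshmans_dream'[OF prime_CHAR]) (simp add: q_eq flip: power_mult)

lemma power_q_sum: "sum f A ^ (q ^ i) = (\<Sum>x\<in>A. (f x :: 'a) ^ (q ^ i))"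
  by (rule freshmans_dream_sum'[OF prime_CHAR]) (simp add: q_eq flip: power_mult)

lemma q_pos: "q > 0"
  using prime_CHAR by (simp add: q_eq prime_gt_0_nat)

section \<open>The twisted polynomial ring, as functions on \<open>K\<close>\<close>

text \<open>Ring elements are treated as the functions they induce, so that the ring product is
  composition. The index \<open>k\<close> counts coefficients: \<open>tau_poly 0\<close> holds only
  for the zero function, and no degree of zero has to be fixed.\<close>

definition tau_poly :: "nat \<Rightarrow> ('a \<Rightarrow> 'a) \<Rightarrow> bool" where
  "tau_poly k g \<longleftrightarrow> (\<exists>c. \<forall>t. g t = (\<Sum>i<k. c i * t ^ (q ^ i)))"

definition qlin :: "('a \<Rightarrow> 'a) \<Rightarrow> bool" where
  "qlin g \<longleftrightarrow> (\<exists>k. tau_poly k g)"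

lemma tau_poly_0: "tau_poly 0 g \<longleftrightarrow> g = (\<lambda>t. 0)"
  by (auto simp: tau_poly_def)

lemma tau_poly_Suc: "tau_poly (Suc k) g \<longleftrightarrow> (\<exists>h a. tau_poly k h \<and> g = (\<lambda>t. h t + a * t ^ (q ^ k)))"
proof
  assume "tau_poly (Suc k) g"
  then obtain c where c: "\<forall>t. g t = (\<Sum>i<Suc k. c i * t ^ (q ^ i))" by (auto simp: tau_poly_def)
  have "tau_poly k (\<lambda>t. \<Sum>i<k. c i * t ^ (q ^ i))" unfolding tau_poly_def by (rule exI[of _ c]) simp
  moreover have "g = (\<lambda>t. (\<Sum>i<k. c i * t ^ (q ^ i)) + c k * t ^ (q ^ k))" using c by auto
  ultimately show "\<exists>h a. tau_poly k h \<and> g = (\<lambda>t. h t + a * t ^ (q ^ k))" by blast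
next
  assume "\<exists>h a. tau_poly k h \<and> g = (\<lambda>t. h t + a * t ^ (q ^ k))"
  then obtain h a c where c: "\<forall>t. h t = (\<Sum>i<k. c i * t ^ (q ^ i))" "g = (\<lambda>t. h t + a * t ^ (q ^ k))"
    by (auto simp: tau_poly_def)
  show "tau_poly (Suc k) g" unfolding tau_poly_def
    by (rule exI[of _ "c(k := a)"]) (auto simp: c)
qed

lemma tau_poly_mono:
  assumes "tau_poly k g" "k \<le> k'"
  shows "tau_poly k' g"
proof -
  obtain c where c: "\<forall>t. g t = (\<Sum>i<k. c i * t ^ (q ^ i))" using assms by (auto simp: tau_poly_def)
  show ?thesis unfolding tau_poly_def
  proof (rule exI[of _ "\<lambda>i. if i < k then c i else 0"], intro allI)
    fix t
    have "(\<Sum>i<k'. (if i < k then c i else 0) * t ^ (q ^ i)) = (\<Sum>i<k. c i * t ^ (q ^ i))"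
      by (rule sum.mono_neutral_cong_right) (use assms in auto)
    then show "g t = (\<Sum>i<k'. (if i < k then c i else 0) * t ^ (q ^ i))" using c by simp
  qed
qed

lemma tau_poly_add:
  assumes "tau_poly k g" "tau_poly k h"
  shows "tau_poly k (\<lambda>t. g t + h t)"
proof -
  obtain c d where "\<forall>t. g t = (\<Sum>i<k. c i * t ^ (q ^ i))" "\<forall>t. h t = (\<Sum>i<k. d i * t ^ (q ^ i))"
    using assms by (auto simp: tau_poly_def)
  then show ?thesis unfolding tau_poly_def
    by (intro exI[of _ "\<lambda>i. c i + d i"]) (simp add: sum.distrib algebra_simps)
qed

text \<open>Left multiplication by a monomial. Raising to the power \<open>q ^ s\<close> is additive
  in characteristic p, so it acts term by term: coefficients are raised to \<open>q ^ s\<close> and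
  move up by \<open>s\<close> places.\<close>

lemma tau_poly_smult_power:
  assumes "tau_poly k g"
  shows "tau_poly (k + s) (\<lambda>t. a * g t ^ (q ^ s))"
proof -
  obtain c where c: "\<forall>t. g t = (\<Sum>i<k. c i * t ^ (q ^ i))" using assms by (auto simp: tau_poly_def)
  show ?thesis unfolding tau_poly_def
  \<comment> \<open>The case \<open>i < s\<close> puts 0 into the vacated low places, where
    \<open>i - s\<close> would be cut off at 0.\<close>
  proof (rule exI[of _ "\<lambda>i. if i < s then 0 else a * c (i - s) ^ (q ^ s)"], intro allI)
    fix t
    have "a * g t ^ (q ^ s) = (\<Sum>i<k. a * c i ^ (q ^ s) * t ^ (q ^ (i + s)))"
      by (simp add: c power_q_sum sum_distrib_left power_mult_distrib power_add mult.assoc flip: power_mult)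
    also have "\<dots> = (\<Sum>i\<in>{s..<k+s}. a * c (i - s) ^ (q ^ s) * t ^ (q ^ i))"
      by (rule sum.reindex_bij_witness[of _ "\<lambda>i. i - s" "\<lambda>i. i + s"]) auto
    also have "\<dots> = (\<Sum>i<k+s. (if i < s then 0 else a * c (i - s) ^ (q ^ s)) * t ^ (q ^ i))"
      by (rule sum.mono_neutral_cong_left) auto
    finally show "a * g t ^ (q ^ s) = (\<Sum>i<k+s. (if i < s then 0 else a * c (i - s) ^ (q ^ s)) * t ^ (q ^ i))" .
  qed
qed

lemma qlin_zero: "qlin (\<lambda>t. 0)"
  using tau_poly_0 unfolding qlin_def by blast

lemma qlin_add:
  assumes "qlin g" "qlin h"
  shows "qlin (\<lambda>t. g t + h t)"
proof -
  obtain k l where "tau_poly k g" "tau_poly l h" using assms by (auto simp: qlin_def)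
  then have "tau_poly (max k l) g" "tau_poly (max k l) h" using tau_poly_mono by auto
  then show ?thesis using tau_poly_add qlin_def by blast
qed

lemma qlin_smult_power:
  assumes "qlin g"
  shows "qlin (\<lambda>t. a * g t ^ (q ^ s))"
  using assms tau_poly_smult_power unfolding qlin_def by blast

lemma qlin_ident: "qlin (\<lambda>t. t)"
  unfolding qlin_def tau_poly_def by (rule exI[of _ 1], rule exI[of _ "\<lambda>_. 1"]) simp

lemma qlin_uminus: "qlin g \<Longrightarrow> qlin (\<lambda>t. - g t)"
  using qlin_smult_power[of g "-1" 0] by simp

text \<open>Closure under the ring product: the outer function is built up by its top terms, and a
  monomial applied to \<open>h\<close> is covered by \<open>qlin_smult_power\<close>.\<close>

lemma qlin_compose:
  assumes "qlin g" "qlin h"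
  shows "qlin (\<lambda>t. g (h t))"
proof -
  obtain k where "tau_poly k g" using assms by (auto simp: qlin_def)
  then show ?thesis
  proof (induction k arbitrary: g)
    case 0
    then show ?case by (simp add: tau_poly_0 qlin_zero)
  next
    case (Suc k)
    then obtain g' a where "tau_poly k g'" "g = (\<lambda>t. g' t + a * t ^ (q ^ k))"
      by (auto simp: tau_poly_Suc)
    then show ?case using Suc.IH qlin_add qlin_smult_power assms(2) by simp
  qed
qed

lemma qlin_apply_add:
  assumes "qlin g"
  shows "g (x + y) = g x + g y"
  using assms by (auto simp: qlin_def tau_poly_def power_q_add algebra_simps sum.distrib)

lemma qlin_apply_0:
  assumes "qlin g"
  shows "g 0 = 0"
  using qlin_apply_add[OF assms, of 0 0] by (metis add.right_neutral add_left_cancel)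

lemma qlin_apply_uminus:
  assumes "qlin g"
  shows "g (- x) = - g x"
  using qlin_apply_add[OF assms, of x "-x"] qlin_apply_0[OF assms]
  by (simp add: eq_neg_iff_add_eq_0 add.commute)

lemma qlin_apply_sum:
  assumes "qlin g"
  shows "g (sum f A) = (\<Sum>x\<in>A. g (f x))"
  by (induction A rule: infinite_finite_induct) (simp_all add: qlin_apply_0 qlin_apply_add assms)

lemma qlin_iff_qlin_polys: "qlin g \<longleftrightarrow> (\<exists>P\<in>qlin_polys q. g = poly P)"
proof
  assume "qlin g"
  then obtain k where "tau_poly k g" by (auto simp: qlin_def)
  \<comment> \<open>\<open>tau_poly\<close> sums over \<open>i < k\<close> with \<open>k = 0\<close>
    allowed, \<open>qlin_polys\<close> over \<open>i \<le> d\<close> with at least one term; one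
    extra zero coefficient bridges the two.\<close>
  then have "tau_poly (Suc k) g" using tau_poly_mono by simp
  then obtain c where c: "\<forall>t. g t = (\<Sum>i<Suc k. c i * t ^ (q ^ i))" by (auto simp: tau_poly_def)
  show "\<exists>P\<in>qlin_polys q. g = poly P"
  proof
    show "(\<Sum>i\<le>k. monom (c i) (q ^ i)) \<in> qlin_polys q" by (auto simp: qlin_polys_def)
    show "g = poly (\<Sum>i\<le>k. monom (c i) (q ^ i))"
      using c by (auto simp: poly_sum poly_monom lessThan_Suc_atMost)
  qed
next
  assume "\<exists>P\<in>qlin_polys q. g = poly P"
  then obtain d c where "g = poly (\<Sum>i\<le>d. monom (c i) (q ^ i))" by (auto simp: qlin_polys_def)
  then have "tau_poly (Suc d) g" unfolding tau_poly_def
    by (intro exI[of _ c]) (simp add: poly_sum poly_monom flip: lessThan_Suc_atMost)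
  then show "qlin g" by (auto simp: qlin_def)
qed

lemma qlin_polys_coeff_0: "P \<in> qlin_polys q \<Longrightarrow> coeff (P :: 'a poly) 0 = 0"
  using q_pos by (auto simp: qlin_polys_def coeff_sum)

text \<open>Without constant term a nonzero polynomial has positive degree. Subtracting
  \<open>y\<close> keeps the degree positive, and \<open>K\<close> being algebraically closed
  supplies a root.\<close>

lemma qlin_surj:
  assumes "qlin g" "g \<noteq> (\<lambda>t. 0)"
  shows "\<exists>t. g t = y"
proof -
  obtain P where P: "P \<in> qlin_polys q" "g = poly P" using assms(1) by (auto simp: qlin_iff_qlin_polys)
  then have "P \<noteq> 0" using assms(2) by auto
  then have "degree P > 0" using qlin_polys_coeff_0[OF P(1)] by (metis gr0I leading_coeff_0_iff)
  then have "degree (P + [:- y:]) > 0" by (simp add: degree_add_eq_left)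
  then obtain t where "poly (P + [:- y:]) t = 0" using alg_closed_imp_poly_has_root by blast
  then show ?thesis using P by auto
qed

lemma qlin_finite_zeros:
  assumes "qlin g" "g \<noteq> (\<lambda>t. 0)"
  shows "finite {t. g t = 0}"
proof -
  obtain P where P: "P \<in> qlin_polys q" "g = poly P" using assms(1) by (auto simp: qlin_iff_qlin_polys)
  then have "P \<noteq> 0" using assms(2) by auto
  then show ?thesis using P poly_roots_finite by auto
qed

text \<open>Right division with remainder in \<open>K{\<tau>}\<close> by a nonzero element of least degree.\<close>

lemma left_ideal_principal:
  assumes qlin: "\<And>A. A \<in> I \<Longrightarrow> qlin A"
    and zero: "(\<lambda>t. 0) \<in> I"
    and diff: "\<And>A B C. A \<in> I \<Longrightarrow> B \<in> I \<Longrightarrow> qlin C \<Longrightarrow> (\<lambda>t. A t - C (B t)) \<in> I"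
  shows "\<exists>P\<in>I. \<forall>A\<in>I. \<exists>C. qlin C \<and> A = (\<lambda>t. C (P t))"
proof (cases "\<exists>A\<in>I. A \<noteq> (\<lambda>t. 0)")
  case False
  then show ?thesis using zero qlin_zero by blast
next
  case True
  then have "\<exists>k. \<exists>A\<in>I. A \<noteq> (\<lambda>t. 0) \<and> tau_poly k A" using qlin qlin_def by blast
  then obtain d where d: "\<exists>A\<in>I. A \<noteq> (\<lambda>t. 0) \<and> tau_poly d A"
    and min: "\<And>k. k < d \<Longrightarrow> \<not> (\<exists>A\<in>I. A \<noteq> (\<lambda>t. 0) \<and> tau_poly k A)"
    using exists_least_iff[of "\<lambda>k. \<exists>A\<in>I. A \<noteq> (\<lambda>t. 0) \<and> tau_poly k A"] by auto
  obtain P where P: "P \<in> I" "P \<noteq> (\<lambda>t. 0)" "tau_poly d P" using d by blast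
  \<comment> \<open>\<open>d\<close> is positive, since only the zero function has no coefficients;
    \<open>b\<close> below is the leading coefficient of \<open>P\<close>, nonzero by minimality of
    \<open>d\<close>.\<close>
  obtain d' where d': "d = Suc d'" using P by (cases d) (auto simp: tau_poly_0)
  obtain h b where h: "tau_poly d' h" "P = (\<lambda>t. h t + b * t ^ (q ^ d'))"
    using P(3) by (auto simp: d' tau_poly_Suc)
  have b: "b \<noteq> 0"
  proof
    assume "b = 0"
    then have "tau_poly d' P" using h by simp
    then show False using min[of d'] P d' by blast
  qed
  have "\<exists>C. qlin C \<and> A = (\<lambda>t. C (P t))" if "A \<in> I" "tau_poly k A" for k A
    using that
  proof (induction k arbitrary: A)
    case 0
    then show ?case using qlin_zero by (auto simp: tau_poly_0)
  next
    case (Suc k)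
    then obtain g a where g: "tau_poly k g" "A = (\<lambda>t. g t + a * t ^ (q ^ k))"
      by (auto simp: tau_poly_Suc)
    show ?case
    proof (cases "a = 0 \<or> A = (\<lambda>t. 0)")
      case True
      then show ?thesis using Suc g qlin_zero by auto
    next
      case False
      then have "\<not> Suc k < d" using min[of "Suc k"] Suc.prems by blast
      then obtain s where s: "k = d' + s" using d' by (metis le_iff_add less_Suc_eq_le not_less_eq)
      \<comment> \<open>The monomial for which \<open>D (P t)\<close> has leading term
        \<open>a * t ^ (q ^ k)\<close>. As constants do not commute with the Frobenius map,
        \<open>b\<close> is divided out as \<open>b ^ (q ^ s)\<close>.\<close>
      define D where "D = (\<lambda>t::'a. (a / b ^ (q ^ s)) * t ^ (q ^ s))"
      have D: "qlin D" unfolding D_def by (rule qlin_smult_power[OF qlin_ident])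
      have eq: "(\<lambda>t. A t - D (P t)) = (\<lambda>t. g t + (- (a / b ^ (q ^ s))) * h t ^ (q ^ s))"
      proof
        fix t
        have "(b * t ^ q ^ d') ^ q ^ s = b ^ q ^ s * t ^ (q ^ k)"
          by (simp add: s power_mult_distrib power_add flip: power_mult)
        then show "A t - D (P t) = g t + (- (a / b ^ (q ^ s))) * h t ^ (q ^ s)"
          using b by (simp add: D_def h g power_q_add field_simps)
      qed
      have "tau_poly k (\<lambda>t. A t - D (P t))" unfolding eq
        by (rule tau_poly_add[OF g(1)]) (unfold s, rule tau_poly_smult_power[OF h(1)])
      moreover have "(\<lambda>t. A t - D (P t)) \<in> I" using diff Suc.prems P D by blast
      ultimately obtain C where C: "qlin C" "(\<lambda>t. A t - D (P t)) = (\<lambda>t. C (P t))" using Suc.IH by blast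
      have "A = (\<lambda>t. C (P t) + D (P t))" using C(2) by (metis diff_add_cancel)
      then show ?thesis using qlin_add[OF C(1) D] by blast
    qed
  qed
  then show ?thesis using P(1) qlin qlin_def by blast
qed

section \<open>Additive forms in \<open>n\<close> variables\<close>

text \<open>The elements of \<open>Lambda q n\<close> as functions. Only values on
  \<open>carrier_vec n\<close> are constrained, as the vector type also contains vectors of other
  dimensions.\<close>

definition lam :: "nat \<Rightarrow> ('a vec \<Rightarrow> 'a) \<Rightarrow> bool" where
  "lam n \<phi> \<longleftrightarrow> (\<exists>g. (\<forall>i<n. qlin (g i)) \<and> (\<forall>x\<in>carrier_vec n. \<phi> x = (\<Sum>i<n. g i (x $ i))))"

lemma lam_iff_Lambda: "lam n \<phi> \<longleftrightarrow> (\<exists>f\<in>Lambda q n. \<forall>x\<in>carrier_vec n. \<phi> x = eval_Lambda f x)"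
proof
  assume "lam n \<phi>"
  then obtain g where g: "\<forall>i<n. qlin (g i)" "\<forall>x\<in>carrier_vec n. \<phi> x = (\<Sum>i<n. g i (x $ i))"
    by (auto simp: lam_def)
  have "\<forall>i. \<exists>P. i < n \<longrightarrow> P \<in> qlin_polys q \<and> g i = poly P" using g(1) qlin_iff_qlin_polys by blast
  then obtain P where P: "\<And>i. i < n \<Longrightarrow> P i \<in> qlin_polys q \<and> g i = poly (P i)" by metis
  show "\<exists>f\<in>Lambda q n. \<forall>x\<in>carrier_vec n. \<phi> x = eval_Lambda f x"
    by (rule bexI[of _ "vec n P"]) (use P g in \<open>auto simp: Lambda_def eval_Lambda_def\<close>)
next
  assume "\<exists>f\<in>Lambda q n. \<forall>x\<in>carrier_vec n. \<phi> x = eval_Lambda f x"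
  then obtain f where f: "f \<in> Lambda q n" "\<forall>x\<in>carrier_vec n. \<phi> x = eval_Lambda f x" by blast
  show "lam n \<phi>" unfolding lam_def
    by (rule exI[of _ "\<lambda>i. poly (f $ i)"])
      (use f in \<open>auto simp: Lambda_def eval_Lambda_def qlin_iff_qlin_polys\<close>)
qed

text \<open>Allows equations to be given as functions, so that sums, multiples and substitutions
  need no computation with tuples of polynomials.\<close>

lemma q_variety_iff_lam:
  "q_variety q n F \<longleftrightarrow> (\<exists>S. (\<forall>\<phi>\<in>S. lam n \<phi>) \<and> F = {x \<in> carrier_vec n. \<forall>\<phi>\<in>S. \<phi> x = 0})"
proof
  assume "q_variety q n F"
  then obtain S where S: "S \<subseteq> Lambda q n" "F = {x \<in> carrier_vec n. \<forall>f\<in>S. eval_Lambda f x = 0}"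
    by (auto simp: q_variety_def)
  then show "\<exists>S. (\<forall>\<phi>\<in>S. lam n \<phi>) \<and> F = {x \<in> carrier_vec n. \<forall>\<phi>\<in>S. \<phi> x = 0}"
    by (intro exI[of _ "eval_Lambda ` S"]) (auto simp: lam_iff_Lambda)
next
  assume "\<exists>S. (\<forall>\<phi>\<in>S. lam n \<phi>) \<and> F = {x \<in> carrier_vec n. \<forall>\<phi>\<in>S. \<phi> x = 0}"
  then obtain S where S: "\<forall>\<phi>\<in>S. lam n \<phi>" "F = {x \<in> carrier_vec n. \<forall>\<phi>\<in>S. \<phi> x = 0}" by blast
  then obtain f where "\<forall>\<phi>\<in>S. f \<phi> \<in> Lambda q n \<and> (\<forall>x\<in>carrier_vec n. \<phi> x = eval_Lambda (f \<phi>) x)"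
    by (auto simp: lam_iff_Lambda Bex_def) metis
  then show "q_variety q n F" unfolding q_variety_def S(2)
    by (intro exI[of _ "f ` S"]) auto
qed

lemma lam_zero: "lam n (\<lambda>x. 0)"
  unfolding lam_def using qlin_zero by (intro exI[of _ "\<lambda>i t. 0"]) auto

lemma lam_add:
  assumes "lam n \<phi>" "lam n \<chi>"
  shows "lam n (\<lambda>x. \<phi> x + \<chi> x)"
proof -
  obtain g h where "\<forall>i<n. qlin (g i)" "\<forall>x\<in>carrier_vec n. \<phi> x = (\<Sum>i<n. g i (x $ i))"
    "\<forall>i<n. qlin (h i)" "\<forall>x\<in>carrier_vec n. \<chi> x = (\<Sum>i<n. h i (x $ i))"
    using assms unfolding lam_def by blast
  then show ?thesis unfolding lam_def
    by (intro exI[of _ "\<lambda>i t. g i t + h i t"]) (auto simp: qlin_add sum.distrib)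
qed

lemma lam_qlin:
  assumes "qlin C" "lam n \<phi>"
  shows "lam n (\<lambda>x. C (\<phi> x))"
proof -
  obtain g where "\<forall>i<n. qlin (g i)" "\<forall>x\<in>carrier_vec n. \<phi> x = (\<Sum>i<n. g i (x $ i))"
    using assms(2) unfolding lam_def by blast
  then show ?thesis unfolding lam_def using assms(1)
    by (intro exI[of _ "\<lambda>i t. C (g i t)"]) (auto simp: qlin_compose qlin_apply_sum)
qed

lemma lam_uminus: "lam n \<phi> \<Longrightarrow> lam n (\<lambda>x. - \<phi> x)"
  using lam_qlin[OF qlin_uminus[OF qlin_ident]] by blast

lemma lam_diff:
  assumes "lam n \<phi>" "lam n \<chi>"
  shows "lam n (\<lambda>x. \<phi> x - \<chi> x)"
  using lam_add[OF assms(1) lam_uminus[OF assms(2)]] by simp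

lemma lam_sum:
  assumes "\<And>j. j \<in> A \<Longrightarrow> lam n (\<phi> j)"
  shows "lam n (\<lambda>x. \<Sum>j\<in>A. \<phi> j x)"
  using assms by (induction A rule: infinite_finite_induct) (simp_all add: lam_zero lam_add)

lemma lam_coordinate:
  assumes "i < n"
  shows "lam n (\<lambda>x. x $ i)"
  unfolding lam_def
proof (rule exI[of _ "\<lambda>j t. if j = i then t else 0"], intro conjI allI impI ballI)
  fix j show "qlin (\<lambda>t. if j = i then t else 0)" by (cases "j = i") (simp_all add: qlin_zero qlin_ident)
next
  fix x :: "'a vec"
  show "x $ i = (\<Sum>j<n. if j = i then x $ j else 0)" using assms by simp
qed

lemma lam_cong:
  assumes "lam n \<phi>" "\<And>x. x \<in> carrier_vec n \<Longrightarrow> \<phi> x = \<chi> x"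
  shows "lam n \<chi>"
  using assms by (auto simp: lam_def)

text \<open>Substitution of a polynomial map into an equation, which makes preimages of varieties
  varieties.\<close>

lemma lam_compose:
  assumes "lam m \<phi>" "\<And>j. j < m \<Longrightarrow> lam n (\<psi> j)"
  shows "lam n (\<lambda>x. \<phi> (vec m (\<lambda>j. \<psi> j x)))"
proof -
  obtain g where g: "\<forall>i<m. qlin (g i)" "\<forall>x\<in>carrier_vec m. \<phi> x = (\<Sum>i<m. g i (x $ i))"
    using assms(1) unfolding lam_def by blast
  have "lam n (\<lambda>x. \<Sum>j<m. g j (\<psi> j x))"
    by (rule lam_sum) (use g assms(2) lam_qlin in auto)
  then show ?thesis by (rule lam_cong) (use g in auto)
qed

lemma lam_apply_add:
  assumes "lam n \<phi>" "x \<in> carrier_vec n" "y \<in> carrier_vec n"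
  shows "\<phi> (x + y) = \<phi> x + \<phi> y"
proof -
  obtain g where g: "\<forall>i<n. qlin (g i)" "\<forall>x\<in>carrier_vec n. \<phi> x = (\<Sum>i<n. g i (x $ i))"
    using assms(1) unfolding lam_def by blast
  have "\<phi> (x + y) = (\<Sum>i<n. g i (x $ i) + g i (y $ i))"
    using assms g by (simp add: qlin_apply_add)
  then show ?thesis using assms g by (simp add: sum.distrib)
qed

lemma lam_apply_diff:
  assumes "lam n \<phi>" "x \<in> carrier_vec n" "y \<in> carrier_vec n"
  shows "\<phi> (x - y) = \<phi> x - \<phi> y"
proof -
  have "x = (x - y) + y" using assms(2,3) by (auto intro!: eq_vecI)
  then have "\<phi> x = \<phi> (x - y) + \<phi> y"
    using lam_apply_add[OF assms(1), of "x - y" y] assms(2,3) by (metis minus_carrier_vec)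
  then show ?thesis by simp
qed

lemma lam_apply_0:
  assumes "lam n \<phi>"
  shows "\<phi> (0\<^sub>v n) = 0"
  using lam_apply_diff[OF assms, of "0\<^sub>v n" "0\<^sub>v n"] by simp

end

subsection \<open>Varieties, elimination and images\<close>

text \<open>The vector type mixes all dimensions and is no group itself, so subgroups are taken
  relative to \<open>carrier_vec n\<close>.\<close>

definition vec_subgroup :: "nat \<Rightarrow> 'a::ab_group_add vec set \<Rightarrow> bool" where
  "vec_subgroup n G \<longleftrightarrow> G \<subseteq> carrier_vec n \<and> 0\<^sub>v n \<in> G \<and>
     (\<forall>x\<in>G. \<forall>y\<in>G. x - y \<in> G) \<and> (\<forall>x\<in>G. \<forall>y\<in>G. x + y \<in> G)"

lemma vec_subgroupD:
  assumes "vec_subgroup n G"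
  shows "x \<in> G \<Longrightarrow> x \<in> carrier_vec n" "0\<^sub>v n \<in> G"
    "x \<in> G \<Longrightarrow> y \<in> G \<Longrightarrow> x - y \<in> G" "x \<in> G \<Longrightarrow> y \<in> G \<Longrightarrow> x + y \<in> G"
  using assms by (auto simp: vec_subgroup_def)

context frobenius_power
begin

lemma q_variety_imp_vec_subgroup:
  assumes "q_variety q n F"
  shows "vec_subgroup n (F :: 'a vec set)"
proof -
  obtain S where S: "\<forall>\<phi>\<in>S. lam n \<phi>" "F = {x \<in> carrier_vec n. \<forall>\<phi>\<in>S. \<phi> x = 0}"
    using assms by (auto simp: q_variety_iff_lam)
  have "\<phi> (x - y) = 0" "\<phi> (x + y) = 0" if "\<phi> \<in> S" "x \<in> F" "y \<in> F" for \<phi> x y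
    using lam_apply_diff[of n \<phi> x y] lam_apply_add[of n \<phi> x y] S that by auto
  moreover have "\<phi> (0\<^sub>v n) = 0" if "\<phi> \<in> S" for \<phi> using lam_apply_0 S(1) that by blast
  ultimately show ?thesis using S(2) by (auto simp: vec_subgroup_def)
qed

lemma q_variety_zeros: "(\<And>\<phi>. \<phi> \<in> S \<Longrightarrow> lam n \<phi>) \<Longrightarrow> q_variety q n {x \<in> carrier_vec n. \<forall>\<phi>\<in>S. \<phi> x = 0}"
  by (auto simp: q_variety_iff_lam)

lemma q_variety_inter:
  assumes "q_variety q n F" "q_variety q n G"
  shows "q_variety q n (F \<inter> G :: 'a vec set)"
proof -
  obtain S where S: "\<forall>\<phi>\<in>S. lam n \<phi>" "F = {x \<in> carrier_vec n. \<forall>\<phi>\<in>S. \<phi> x = 0}"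
    using assms by (auto simp: q_variety_iff_lam)
  obtain T where T: "\<forall>\<phi>\<in>T. lam n \<phi>" "G = {x \<in> carrier_vec n. \<forall>\<phi>\<in>T. \<phi> x = 0}"
    using assms by (auto simp: q_variety_iff_lam)
  have "F \<inter> G = {x \<in> carrier_vec n. \<forall>\<phi>\<in>S \<union> T. \<phi> x = 0}" using S T by auto
  also have "q_variety q n \<dots>" by (rule q_variety_zeros) (use S(1) T(1) in blast)
  finally show ?thesis .
qed

lemma q_variety_vimage:
  assumes "q_variety q m G" "\<And>j. j < m \<Longrightarrow> lam n (\<psi> j)"
  shows "q_variety q n {x \<in> carrier_vec n. vec m (\<lambda>j. \<psi> j x) \<in> G}"
proof -
  obtain S where S: "\<forall>\<phi>\<in>S. lam m \<phi>" "G = {x \<in> carrier_vec m. \<forall>\<phi>\<in>S. \<phi> x = 0}"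
    using assms by (auto simp: q_variety_iff_lam)
  have "{x \<in> carrier_vec n. vec m (\<lambda>j. \<psi> j x) \<in> G} =
      {x \<in> carrier_vec n. \<forall>\<chi>\<in>(\<lambda>\<phi> x. \<phi> (vec m (\<lambda>j. \<psi> j x))) ` S. \<chi> x = 0}"
    using S by auto
  also have "q_variety q n \<dots>" by (rule q_variety_zeros) (use S assms(2) lam_compose in auto)
  finally show ?thesis .
qed

lemma q_variety_singleton_0: "q_variety q n {0\<^sub>v n :: 'a vec}"
proof -
  have "{0\<^sub>v n :: 'a vec} = {x \<in> carrier_vec n. \<forall>\<phi>\<in>(\<lambda>i x. x $ i) ` {..<n}. \<phi> x = 0}"
    by (auto intro!: eq_vecI)
  also have "q_variety q n \<dots>" by (rule q_variety_zeros) (auto simp: lam_coordinate)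
  finally show ?thesis .
qed

lemma lam_coordinate_or_0: "lam n (\<lambda>x. if i < n then x $ i else 0)"
  by (cases "i < n") (simp_all add: lam_coordinate lam_zero)

text \<open>
  Elimination of the last variable: the leading parts of the equations form a left ideal, so a
  single equation involves the last variable, and it can be solved for any values of the others.
\<close>

lemma q_variety_projection:
  assumes "q_variety q (Suc n) (F :: 'a vec set)"
  shows "q_variety q n ((\<lambda>x. vec n (\<lambda>i. x $ i)) ` F)"
proof -
  define ext :: "'a vec \<Rightarrow> 'a \<Rightarrow> 'a vec" where
    "ext = (\<lambda>y t. vec (Suc n) (\<lambda>i. if i < n then y $ i else t))"
  have ext_carrier: "ext y t \<in> carrier_vec (Suc n)" for y t by (simp add: ext_def)
  have ext_split: "ext y t = ext y 0 + ext (0\<^sub>v n) t" for y t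
    by (intro eq_vecI) (auto simp: ext_def)
  \<comment> \<open>All equations valid on \<open>F\<close>, not just a defining set: this family is
    closed under left combinations, which makes \<open>I\<close> below a left ideal.\<close>
  define M where "M = {\<phi>. lam (Suc n) \<phi> \<and> (\<forall>x\<in>F. \<phi> x = 0)}"
  have M_lam: "lam (Suc n) \<phi>" if "\<phi> \<in> M" for \<phi> using that by (simp add: M_def)
  obtain S where S: "\<forall>\<phi>\<in>S. lam (Suc n) \<phi>" "F = {x \<in> carrier_vec (Suc n). \<forall>\<phi>\<in>S. \<phi> x = 0}"
    using assms by (auto simp: q_variety_iff_lam)
  have F_eq: "F = {x \<in> carrier_vec (Suc n). \<forall>\<phi>\<in>M. \<phi> x = 0}"
    using S by (auto simp: M_def)
  have M_split: "\<phi> (ext y t) = \<phi> (ext y 0) + \<phi> (ext (0\<^sub>v n) t)" if "\<phi> \<in> M" for \<phi> y t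
    using lam_apply_add[OF M_lam[OF that] ext_carrier ext_carrier] ext_split[of y t] by metis
  have lam_head: "lam n (\<lambda>y. \<phi> (ext y 0))" if "\<phi> \<in> M" for \<phi>
    unfolding ext_def by (rule lam_compose[OF M_lam[OF that]]) (simp add: lam_coordinate_or_0)
  have qlin_last: "qlin (\<lambda>t. \<phi> (ext (0\<^sub>v n) t))" if \<phi>: "\<phi> \<in> M" for \<phi>
  proof -
    obtain g where g: "\<forall>i<Suc n. qlin (g i)" "\<forall>x\<in>carrier_vec (Suc n). \<phi> x = (\<Sum>i<Suc n. g i (x $ i))"
      using M_lam[OF \<phi>] unfolding lam_def by blast
    have "\<phi> (ext (0\<^sub>v n) t) = g n t" for t
      using g by (simp add: ext_carrier) (simp add: ext_def qlin_apply_0)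
    then show ?thesis using g(1) by simp
  qed
  define I where "I = (\<lambda>\<phi> t. \<phi> (ext (0\<^sub>v n) t)) ` M"
  have M_diff: "(\<lambda>x. \<phi> x - C (\<chi> x)) \<in> M" if "\<phi> \<in> M" "\<chi> \<in> M" "qlin C" for \<phi> \<chi> C
    using that by (auto simp: M_def lam_diff lam_qlin qlin_apply_0)
  have "\<exists>P\<in>I. \<forall>A\<in>I. \<exists>C. qlin C \<and> A = (\<lambda>t. C (P t))"
  proof (rule left_ideal_principal)
    show "qlin A" if "A \<in> I" for A using that qlin_last by (auto simp: I_def)
    show "(\<lambda>t. 0) \<in> I" unfolding I_def by (rule image_eqI[of _ _ "\<lambda>x. 0"]) (auto simp: M_def lam_zero)
    fix A B C assume "A \<in> I" "B \<in> I" and C: "qlin C"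
    then obtain \<phi> \<chi> where "\<phi> \<in> M" "\<chi> \<in> M" "A = (\<lambda>t. \<phi> (ext (0\<^sub>v n) t))" "B = (\<lambda>t. \<chi> (ext (0\<^sub>v n) t))"
      by (auto simp: I_def)
    then show "(\<lambda>t. A t - C (B t)) \<in> I" unfolding I_def
      by (intro image_eqI[of _ _ "\<lambda>x. \<phi> x - C (\<chi> x)"]) (auto simp: M_diff C)
  qed
  then obtain \<phi>0 where \<phi>0: "\<phi>0 \<in> M"
    and quot: "\<And>\<phi>. \<phi> \<in> M \<Longrightarrow> \<exists>C. qlin C \<and> (\<forall>t. \<phi> (ext (0\<^sub>v n) t) = C (\<phi>0 (ext (0\<^sub>v n) t)))"
    unfolding I_def by (auto simp: fun_eq_iff)
  \<comment> \<open>The equations in which the last variable does not occur; they cut out the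
    projection.\<close>
  define M' where "M' = {\<phi> \<in> M. \<forall>t. \<phi> (ext (0\<^sub>v n) t) = 0}"
  have "(\<lambda>x. vec n (\<lambda>i. x $ i)) ` F = {y \<in> carrier_vec n. \<forall>\<chi>\<in>(\<lambda>\<phi> y. \<phi> (ext y 0)) ` M'. \<chi> y = 0}"
    (is "_ = ?Z")
  proof (intro equalityI subsetI)
    fix y assume "y \<in> (\<lambda>x. vec n (\<lambda>i. x $ i)) ` F"
    then obtain x where x: "x \<in> F" "y = vec n (\<lambda>i. x $ i)" by blast
    have x_eq: "ext y (x $ n) = x"
      using x F_eq by (intro eq_vecI) (auto simp: ext_def less_Suc_eq)
    have "\<phi> (ext y 0) = 0" if "\<phi> \<in> M'" for \<phi>
      using M_split[of \<phi> y "x $ n"] that x(1) by (simp add: M'_def x_eq) (simp add: M_def)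
    then show "y \<in> ?Z" using x by auto
  next
    fix y assume y: "y \<in> ?Z"
    have zero: "\<phi> (ext y 0) = 0" if "\<phi> \<in> M'" for \<phi> using y that by auto
    \<comment> \<open>Solve the generating equation \<open>\<phi>0\<close> for the last coordinate.
      If its last part vanishes, then \<open>\<phi>0\<close> lies in \<open>M'\<close> and both
      sides are 0; otherwise that part is surjective.\<close>
    have "\<exists>t. \<phi>0 (ext (0\<^sub>v n) t) = - \<phi>0 (ext y 0)"
    proof (cases "\<phi>0 \<in> M'")
      case True
      then show ?thesis using zero by (auto simp: M'_def)
    next
      case False
      then have "(\<lambda>t. \<phi>0 (ext (0\<^sub>v n) t)) \<noteq> (\<lambda>t. 0)" using \<phi>0 by (auto simp: M'_def fun_eq_iff)
      then show ?thesis using qlin_surj[OF qlin_last[OF \<phi>0]] by blast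
    qed
    then obtain t where t: "\<phi>0 (ext (0\<^sub>v n) t) = - \<phi>0 (ext y 0)" by blast
    have "\<phi> (ext y t) = 0" if \<phi>: "\<phi> \<in> M" for \<phi>
    proof -
      obtain C where C: "qlin C" "\<And>t. \<phi> (ext (0\<^sub>v n) t) = C (\<phi>0 (ext (0\<^sub>v n) t))"
        using quot[OF \<phi>] by blast
      \<comment> \<open>Subtracting this multiple of \<open>\<phi>0\<close> cancels the last
        variable, so \<open>y\<close> satisfies the difference, and \<open>\<phi>\<close> vanishes
        at \<open>ext y t\<close> because \<open>\<phi>0\<close> does.\<close>
      have "(\<lambda>x. \<phi> x - C (\<phi>0 x)) \<in> M'" using M_diff[OF \<phi> \<phi>0 C(1)] C(2) by (simp add: M'_def)
      then have "\<phi> (ext y 0) = C (\<phi>0 (ext y 0))" using zero by fastforce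
      then show ?thesis using M_split[OF \<phi>, of y t] C t by (simp add: qlin_apply_uminus)
    qed
    then have "ext y t \<in> F" by (subst F_eq) (simp add: ext_carrier)
    moreover have "y = vec n (\<lambda>i. ext y t $ i)" using y by (intro eq_vecI) (auto simp: ext_def)
    ultimately show "y \<in> (\<lambda>x. vec n (\<lambda>i. x $ i)) ` F" by blast
  qed
  also have "q_variety q n \<dots>"
    by (rule q_variety_zeros) (auto simp: M'_def lam_head)
  finally show ?thesis .
qed

lemma q_variety_projection_add:
  assumes "q_variety q (n + k) (F :: 'a vec set)"
  shows "q_variety q n ((\<lambda>x. vec n (\<lambda>i. x $ i)) ` F)"
  using assms
proof (induction k arbitrary: F)
  case 0
  have "vec n (\<lambda>i. x $ i) = x" if "x \<in> F" for x
    using vec_subgroupD(1)[OF q_variety_imp_vec_subgroup[OF 0] that] by (intro eq_vecI) auto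
  then have "(\<lambda>x. vec n (\<lambda>i. x $ i)) ` F = F" by force
  then show ?case using 0 by simp
next
  case (Suc k)
  then have "q_variety q (n + k) ((\<lambda>x. vec (n + k) (\<lambda>i. x $ i)) ` F)"
    using q_variety_projection[of "n + k" F] by simp
  from Suc.IH[OF this]
  have "q_variety q n ((\<lambda>x. vec n (\<lambda>i. vec (n + k) (\<lambda>i. x $ i) $ i)) ` F)"
    by (simp only: image_image)
  moreover have "vec n (\<lambda>i. vec (n + k) (\<lambda>i. x $ i) $ i) = vec n (\<lambda>i. x $ i)" for x :: "'a vec"
    by (intro eq_vecI) auto
  ultimately show ?case by (simp only:)
qed

text \<open>The image is a projection of the graph.\<close>

lemma q_variety_image:
  assumes F: "q_variety q n F" and \<psi>: "\<And>j. j < m \<Longrightarrow> lam n (\<psi> j)"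
  shows "q_variety q m ((\<lambda>x. vec m (\<lambda>j. \<psi> j x)) ` F)"
proof -
  \<comment> \<open>In the graph the image coordinates come first and the argument, read off by
    \<open>snd'\<close>, last, because \<open>q_variety_projection_add\<close> keeps an initial
    segment.\<close>
  define snd' :: "'a vec \<Rightarrow> 'a vec" where "snd' = (\<lambda>z. vec n (\<lambda>i. z $ (m + i)))"
  define \<Gamma> where "\<Gamma> = {z \<in> carrier_vec (m + n). snd' z \<in> F} \<inter>
    {z \<in> carrier_vec (m + n). \<forall>\<phi>\<in>(\<lambda>j z. z $ j - \<psi> j (snd' z)) ` {..<m}. \<phi> z = 0}"
  have "lam (m + n) (\<lambda>z. z $ j - \<psi> j (snd' z))" if "j < m" for j
    unfolding snd'_def
    by (intro lam_diff lam_coordinate lam_compose \<psi>) (use that in auto)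
  then have "q_variety q (m + n) \<Gamma>" unfolding \<Gamma>_def snd'_def
    by (intro q_variety_inter q_variety_vimage F q_variety_zeros) (auto simp: lam_coordinate)
  then have "q_variety q m ((\<lambda>z. vec m (\<lambda>i. z $ i)) ` \<Gamma>)" by (rule q_variety_projection_add)
  moreover have "(\<lambda>z. vec m (\<lambda>i. z $ i)) ` \<Gamma> = (\<lambda>x. vec m (\<lambda>j. \<psi> j x)) ` F"
  proof (intro equalityI subsetI)
    fix y assume "y \<in> (\<lambda>z. vec m (\<lambda>i. z $ i)) ` \<Gamma>"
    then obtain z where "z \<in> \<Gamma>" and y: "y = vec m (\<lambda>i. z $ i)" by blast
    then have "snd' z \<in> F" "\<forall>j<m. z $ j = \<psi> j (snd' z)" by (auto simp: \<Gamma>_def)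
    then show "y \<in> (\<lambda>x. vec m (\<lambda>j. \<psi> j x)) ` F" using y
      by (intro image_eqI[of _ _ "snd' z"]) (auto intro!: eq_vecI)
  next
    fix y assume "y \<in> (\<lambda>x. vec m (\<lambda>j. \<psi> j x)) ` F"
    then obtain x where x: "x \<in> F" "y = vec m (\<lambda>j. \<psi> j x)" by blast
    have xc: "x \<in> carrier_vec n" using vec_subgroupD(1)[OF q_variety_imp_vec_subgroup[OF F]] x by blast
    have snd: "snd' (y @\<^sub>v x) = x" using x xc by (intro eq_vecI) (auto simp: snd'_def)
    then have "y @\<^sub>v x \<in> \<Gamma>" unfolding \<Gamma>_def using x xc by auto
    moreover have "y = vec m (\<lambda>i. (y @\<^sub>v x) $ i)" using x xc by (intro eq_vecI) auto
    ultimately show "y \<in> (\<lambda>z. vec m (\<lambda>i. z $ i)) ` \<Gamma>" by blast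
  qed
  ultimately show ?thesis by simp
qed

section \<open>The descending chain condition\<close>

text \<open>An equation that is not identically zero on the line is a nonzero polynomial in one
  variable, with finitely many roots.\<close>

lemma q_variety_1_finite_or_UNIV:
  assumes "q_variety q 1 (F :: 'a vec set)"
  shows "finite F \<or> F = carrier_vec 1"
proof -
  obtain S where S: "\<forall>\<phi>\<in>S. lam 1 \<phi>" "F = {x \<in> carrier_vec 1. \<forall>\<phi>\<in>S. \<phi> x = 0}"
    using assms by (auto simp: q_variety_iff_lam)
  show ?thesis
  proof (cases "\<forall>\<phi>\<in>S. \<forall>x\<in>carrier_vec 1. \<phi> x = 0")
    case True
    then show ?thesis using S by auto
  next
    case False
    then obtain \<phi> x where \<phi>: "\<phi> \<in> S" "x \<in> carrier_vec 1" "\<phi> x \<noteq> 0" by blast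
    obtain g where "\<forall>i<1. qlin (g i)" "\<forall>x\<in>carrier_vec 1. \<phi> x = (\<Sum>i<1. g i (x $ i))"
      using S(1) \<phi>(1) unfolding lam_def by blast
    then have g: "qlin (g 0)" "\<forall>x\<in>carrier_vec 1. \<phi> x = g 0 (x $ 0)" by auto
    have "g 0 \<noteq> (\<lambda>t. 0)"
    proof
      assume "g 0 = (\<lambda>t. 0)"
      then show False using g(2) \<phi>(2,3) by metis
    qed
    then have "finite {t. g 0 t = 0}" by (rule qlin_finite_zeros[OF g(1)])
    moreover have "F \<subseteq> (\<lambda>t. vec 1 (\<lambda>_. t)) ` {t. g 0 t = 0}"
    proof
      fix z assume "z \<in> F"
      then have "z \<in> carrier_vec 1" "g 0 (z $ 0) = 0" using S g \<phi> by auto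
      then show "z \<in> (\<lambda>t. vec 1 (\<lambda>_. t)) ` {t. g 0 t = 0}"
        by (intro image_eqI[of _ _ "z $ 0"]) (auto intro!: eq_vecI)
    qed
    ultimately show ?thesis using finite_surj by blast
  qed
qed

end

text \<open>Once some member is finite, a member of least cardinality from there on equals all its
  successors; otherwise the chain is constant.\<close>

lemma antimono_stabilizes_if_finite_or_full:
  fixes A :: "nat \<Rightarrow> 'b set"
  assumes "antimono A" "\<And>i. finite (A i) \<or> A i = U"
  shows "\<exists>N. \<forall>i\<ge>N. A i = A N"
proof (cases "\<forall>i. A i = U")
  case True
  then show ?thesis by auto
next
  case False
  then obtain k where k: "finite (A k)" using assms(2) by blast
  define N where "N = (ARG_MIN (\<lambda>i. card (A i)) i. i \<ge> k)"
  have N: "N \<ge> k" "\<And>i. i \<ge> k \<Longrightarrow> card (A N) \<le> card (A i)"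
    unfolding N_def using arg_min_nat_lemma[of "\<lambda>i. i \<ge> k" k "\<lambda>i. card (A i)"] by auto
  have "A i = A N" if "i \<ge> N" for i
  proof (rule card_subset_eq)
    show fin: "finite (A N)" using k N(1) assms(1) finite_subset antimonoD by metis
    show sub: "A i \<subseteq> A N" using that assms(1) antimonoD by blast
    have "card (A i) \<le> card (A N)" using fin sub by (rule card_mono)
    moreover have "card (A N) \<le> card (A i)" using N that by simp
    ultimately show "card (A i) = card (A N)" by simp
  qed
  then show ?thesis by blast
qed

context frobenius_power
begin

text \<open>
  Induction on \<open>n\<close>: a descending chain stabilizes as soon as its images under the last coordinate
  and its intersections with the kernel of the last coordinate do.
\<close>

lemma q_variety_chain_stabilizes:
  fixes F :: "nat \<Rightarrow> 'a vec set"
  assumes "antimono F" "\<And>i. q_variety q n (F i)"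
  shows "\<exists>N. \<forall>i\<ge>N. F i = F N"
  using assms
proof (induction n arbitrary: F)
  case 0
  have "x = 0\<^sub>v 0" if "x \<in> F i" for x i
    using vec_subgroupD(1)[OF q_variety_imp_vec_subgroup[OF 0(2)] that] by (intro eq_vecI) auto
  moreover have "0\<^sub>v 0 \<in> F i" for i
    using vec_subgroupD(2)[OF q_variety_imp_vec_subgroup[OF 0(2)]] .
  ultimately have "F i = {0\<^sub>v 0}" for i by (intro equalityI subsetI singletonI) (auto simp only: singleton_iff)
  then show ?case by auto
next
  case (Suc n)
  note sub = q_variety_imp_vec_subgroup[OF Suc.prems(2)]
  have anti: "F j \<subseteq> F i" if "i \<le> j" for i j using Suc.prems(1) that by (auto dest: antimonoD)
  define ext :: "'a vec \<Rightarrow> 'a vec" where "ext = (\<lambda>y. vec (Suc n) (\<lambda>i. if i < n then y $ i else 0))"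
  \<comment> \<open>\<open>L\<close> records the last coordinates, \<open>R\<close> the vectors with
    last coordinate 0, viewed in dimension \<open>n\<close>. The one-variable case governs the
    first, the induction hypothesis the second.\<close>
  define L where "L = (\<lambda>i. (\<lambda>x. vec 1 (\<lambda>_. x $ n)) ` F i)"
  define R where "R = (\<lambda>i. {y \<in> carrier_vec n. ext y \<in> F i})"
  have "\<exists>N. \<forall>i\<ge>N. L i = L N"
  proof (rule antimono_stabilizes_if_finite_or_full)
    show "antimono L" unfolding L_def using anti by (intro antimonoI image_mono)
    show "finite (L i) \<or> L i = carrier_vec 1" for i unfolding L_def
      by (intro q_variety_1_finite_or_UNIV q_variety_image[OF Suc.prems(2)] lam_coordinate) simp
  qed
  moreover have "\<exists>N. \<forall>i\<ge>N. R i = R N"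
  proof (rule Suc.IH)
    show "antimono R" unfolding R_def using anti by (intro antimonoI) auto
    show "q_variety q n (R i)" for i unfolding R_def ext_def
      by (intro q_variety_vimage[OF Suc.prems(2)]) (simp add: lam_coordinate_or_0)
  qed
  ultimately obtain N1 N2 where N1: "\<And>i. i \<ge> N1 \<Longrightarrow> L i = L N1" and N2: "\<And>i. i \<ge> N2 \<Longrightarrow> R i = R N2"
    by blast
  define N where "N = max N1 N2"
  have "F N \<subseteq> F i" if i: "i \<ge> N" for i
  proof
    fix x assume x: "x \<in> F N"
    have "L i = L N" "R i = R N" using i N1[of i] N1[of N] N2[of i] N2[of N] by (auto simp: N_def)
    then have "vec 1 (\<lambda>_. x $ n) \<in> L i" using x by (auto simp: L_def)
    then obtain x' where x': "x' \<in> F i" "vec 1 (\<lambda>_. x $ n) = vec 1 (\<lambda>_. x' $ n)" by (auto simp: L_def)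
    then have last: "x $ n = x' $ n" by (metis index_vec less_one)
    have c: "x \<in> carrier_vec (Suc n)" "x' \<in> carrier_vec (Suc n)"
      using vec_subgroupD(1)[OF sub] x x'(1) by blast+
    \<comment> \<open>As \<open>x\<close> and \<open>x'\<close> agree in the last coordinate,
      \<open>R\<close> sees their difference, and \<open>R i = R N\<close> moves it from
      \<open>F N\<close> to \<open>F i\<close>.\<close>
    define y where "y = vec n (\<lambda>i. (x - x') $ i)"
    have ext_y: "ext y = x - x'" using c last
      by (intro eq_vecI) (auto simp: y_def ext_def less_Suc_eq)
    have "x' \<in> F N" using x'(1) anti[OF i] by blast
    then have "x - x' \<in> F N" using vec_subgroupD(3)[OF sub] x by blast
    then have "y \<in> R i" unfolding \<open>R i = R N\<close> by (auto simp: R_def ext_y) (simp add: y_def)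
    then have "(x - x') + x' \<in> F i" using vec_subgroupD(4)[OF sub _ x'(1)] by (auto simp: R_def ext_y)
    moreover have "(x - x') + x' = x" using c by (intro eq_vecI) auto
    ultimately show "x \<in> F i" by simp
  qed
  then show ?case using anti by blast
qed

text \<open>The descending chain condition in the form needed for induction over
  subvarieties.\<close>

lemma wf_q_variety_psubset: "wf {(G, F :: 'a vec set). q_variety q n G \<and> q_variety q n F \<and> G \<subset> F}"
  unfolding wf_iff_no_infinite_down_chain
proof
  assume "\<exists>f. \<forall>i. (f (Suc i), f i) \<in> {(G, F :: 'a vec set). q_variety q n G \<and> q_variety q n F \<and> G \<subset> F}"
  then obtain f :: "nat \<Rightarrow> 'a vec set" where f: "\<And>i. q_variety q n (f i)" "\<And>i. f (Suc i) \<subset> f i" by blast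
  have "antimono f" using f(2) by (auto simp: antimono_iff_le_Suc)
  then obtain N where "\<forall>i\<ge>N. f i = f N" using q_variety_chain_stabilizes f(1) by blast
  then have "f (Suc N) = f N" by (metis le_SucI order_refl)
  then show False using f(2) by blast
qed

end

subsection \<open>Finite index\<close>

definition finite_index :: "'a::ab_group_add vec set \<Rightarrow> 'a vec set \<Rightarrow> bool" where
  "finite_index G F \<longleftrightarrow> (\<exists>A\<subseteq>F. finite A \<and> (\<forall>x\<in>F. \<exists>a\<in>A. x - a \<in> G))"

text \<open>Translates the coset count in \<open>q_irreducible\<close> into representatives; the
  cosets are the translates \<open>c a\<close> of \<open>G\<close>.\<close>

lemma finite_index_iff_rcosets:
  assumes G: "vec_subgroup n G" and F: "vec_subgroup n F" and sub: "G \<subseteq> F"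
  shows "finite (rcosets\<^bsub>add_grp n F\<^esub> G) \<longleftrightarrow> finite_index G F"
proof -
  define c where "c = (\<lambda>a. (\<lambda>h. h + a) ` G)"
  note GD = vec_subgroupD[OF G] and FD = vec_subgroupD[OF F]
  have rc: "rcosets\<^bsub>add_grp n F\<^esub> G = c ` F"
    by (auto simp: RCOSETS_def r_coset_def c_def add_grp_def monoid_vec_def)
  show ?thesis unfolding rc
  proof
    assume "finite (c ` F)"
    then obtain A where A: "A \<subseteq> F" "finite A" "c ` F = c ` A"
      using finite_subset_image[of "c ` F" c F] by auto
    have "\<exists>a\<in>A. x - a \<in> G" if x: "x \<in> F" for x
    proof -
      have "x = 0\<^sub>v n + x" using FD(1)[OF x] by simp
      then have "x \<in> c x" using GD(2) unfolding c_def by (metis image_eqI)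
      moreover obtain a where a: "a \<in> A" "c x = c a" using x A(3) by blast
      ultimately obtain h where h: "h \<in> G" "x = h + a" by (auto simp: c_def)
      have "x - a = h" using h GD(1)[of h] FD(1)[of a] a A(1) by (intro eq_vecI) auto
      then show ?thesis using h a by blast
    qed
    then show "finite_index G F" using A by (auto simp: finite_index_def)
  next
    assume "finite_index G F"
    then obtain A where A: "A \<subseteq> F" "finite A" "\<forall>x\<in>F. \<exists>a\<in>A. x - a \<in> G"
      by (auto simp: finite_index_def)
    have "c x \<in> c ` A" if x: "x \<in> F" for x
    proof -
      obtain a where a: "a \<in> A" "x - a \<in> G" using A x by blast
      have carr: "x \<in> carrier_vec n" "a \<in> carrier_vec n" using x a A(1) FD(1) by auto
      have "h + x \<in> c a" if "h \<in> G" for h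
      proof -
        have "h + x = (h + (x - a)) + a" using carr GD(1)[OF that] by (intro eq_vecI) auto
        then show ?thesis using GD(4)[OF that a(2)] by (simp add: c_def)
      qed
      moreover have "h + a \<in> c x" if "h \<in> G" for h
      proof -
        have "h + a = (h - (x - a)) + x" using carr GD(1)[OF that] by (intro eq_vecI) auto
        then show ?thesis using GD(3)[OF that a(2)] by (simp add: c_def)
      qed
      ultimately have "c x = c a" by (auto simp: c_def)
      then show ?thesis using a by blast
    qed
    then show "finite (c ` F)" using A(2) by (meson finite_imageI finite_subset image_subsetI)
  qed
qed

lemma finite_index_mono: "finite_index G F \<Longrightarrow> G \<subseteq> G' \<Longrightarrow> finite_index G' F"
  unfolding finite_index_def by (meson subsetD)

lemma finite_index_refl:
  assumes "vec_subgroup n F"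
  shows "finite_index F F"
proof -
  have "x - 0\<^sub>v n \<in> F" if "x \<in> F" for x using vec_subgroupD[OF assms] that by blast
  then show ?thesis unfolding finite_index_def using vec_subgroupD(2)[OF assms]
    by (intro exI[of _ "{0\<^sub>v n}"]) auto
qed

text \<open>Reduce \<open>x\<close> modulo \<open>F\<close> by some \<open>b\<close>, then
  \<open>x - b\<close> modulo \<open>G\<close> by some \<open>a\<close>: the sums
  \<open>a + b\<close> form a finite set of representatives.\<close>

lemma finite_index_trans:
  assumes G: "vec_subgroup n G" and E: "vec_subgroup n E" and sub: "F \<subseteq> E"
    and fin: "finite_index G F" "finite_index F E"
  shows "finite_index G E"
proof -
  obtain A where A: "A \<subseteq> F" "finite A" "\<forall>x\<in>F. \<exists>a\<in>A. x - a \<in> G" 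
    using fin unfolding finite_index_def by blast
  obtain B where B: "B \<subseteq> E" "finite B" "\<forall>x\<in>E. \<exists>b\<in>B. x - b \<in> F" 
    using fin unfolding finite_index_def by blast
  note ED = vec_subgroupD[OF E]
  show ?thesis unfolding finite_index_def
  proof (intro exI conjI ballI)
    show "(\<lambda>(a, b). a + b) ` (A \<times> B) \<subseteq> E" using A(1) B(1) sub by (auto intro!: ED(4))
    show "finite ((\<lambda>(a, b). a + b) ` (A \<times> B))" using A(2) B(2) by simp
    fix x assume x: "x \<in> E"
    then obtain b where b: "b \<in> B" "x - b \<in> F" using B by blast
    then obtain a where a: "a \<in> A" "x - b - a \<in> G" using A by blast
    have "x \<in> carrier_vec n" "a \<in> carrier_vec n" "b \<in> carrier_vec n"
      using x a b A(1) B(1) sub ED(1) by auto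
    then have "x - (a + b) = x - b - a" by (intro eq_vecI) auto
    then show "\<exists>c\<in>(\<lambda>(a, b). a + b) ` (A \<times> B). x - c \<in> G" using a b by force
  qed
qed

text \<open>Two elements of \<open>E\<close> are congruent modulo \<open>G \<inter> E\<close> iff
  they are congruent modulo \<open>G\<close>, so only the cosets of \<open>G\<close> that meet
  \<open>E\<close> count.\<close>

lemma finite_index_restrict:
  assumes G: "vec_subgroup n G" and F: "vec_subgroup n F" and E: "vec_subgroup n E"
    and sub: "E \<subseteq> F" and fin: "finite_index G F"
  shows "finite_index (G \<inter> E) E"
proof -
  obtain A where A: "A \<subseteq> F" "finite A" "\<forall>x\<in>F. \<exists>a\<in>A. x - a \<in> G" 
    using fin unfolding finite_index_def by blast
  \<comment> \<open>The given representatives need not lie in \<open>E\<close>. Those whose coset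
    meets \<open>E\<close> are replaced by an element \<open>r a\<close> of \<open>E\<close> in the
    same coset.\<close>
  define A' where "A' = {a \<in> A. \<exists>e\<in>E. e - a \<in> G}"
  have "\<forall>a\<in>A'. \<exists>e. e \<in> E \<and> e - a \<in> G" unfolding A'_def by blast
  then obtain r where r: "\<And>a. a \<in> A' \<Longrightarrow> r a \<in> E \<and> r a - a \<in> G" by (auto dest!: bchoice)
  show ?thesis unfolding finite_index_def
  proof (intro exI conjI ballI)
    show "r ` A' \<subseteq> E" using r by auto
    show "finite (r ` A')" using A(2) by (simp add: A'_def)
    fix x assume x: "x \<in> E"
    then obtain a where a: "a \<in> A" "x - a \<in> G" using A sub by blast
    then have a': "a \<in> A'" using x by (auto simp: A'_def)
    have "x \<in> carrier_vec n" "a \<in> carrier_vec n" "r a \<in> carrier_vec n"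
      using x a A(1) r[OF a'] vec_subgroupD(1)[OF E] vec_subgroupD(1)[OF F] by auto
    then have "x - r a = (x - a) - (r a - a)" by (intro eq_vecI) auto
    then have "x - r a \<in> G" using vec_subgroupD(3)[OF G a(2)] r[OF a'] by simp
    then show "\<exists>c\<in>r ` A'. x - c \<in> G \<inter> E" using a' r[OF a'] vec_subgroupD(3)[OF E x] by blast
  qed
qed

text \<open>Match the image of \<open>x\<close> with that of some \<open>b\<close> up to an element
  of the image of \<open>V\<close>, say that of \<open>v\<close>. Then \<open>x - b - v\<close> is
  in the kernel, where a representative \<open>a\<close> reduces it into \<open>V\<close>, and
  \<open>a + b\<close> represents \<open>x\<close>.\<close>

lemma finite_index_if_kernel_image:
  fixes \<psi> :: "'a::ab_group_add vec \<Rightarrow> 'b::ab_group_add vec"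
  assumes V: "vec_subgroup n V" and V': "vec_subgroup n V'" and sub: "V \<subseteq> V'"
    and diff: "\<And>x y. x \<in> carrier_vec n \<Longrightarrow> y \<in> carrier_vec n \<Longrightarrow> \<psi> (x - y) = \<psi> x - \<psi> y"
    and range: "\<And>x. x \<in> carrier_vec n \<Longrightarrow> \<psi> x \<in> carrier_vec m"
    and K: "K = {x \<in> carrier_vec n. \<psi> x = 0\<^sub>v m}"
    and fin: "finite_index (V \<inter> K) (V' \<inter> K)" "finite_index (\<psi> ` V) (\<psi> ` V')"
  shows "finite_index V V'"
proof -
  obtain A where A: "A \<subseteq> V' \<inter> K" "finite A" "\<forall>x\<in>V' \<inter> K. \<exists>a\<in>A. x - a \<in> V \<inter> K"
    using fin unfolding finite_index_def by blast
  obtain B where B: "B \<subseteq> \<psi> ` V'" "finite B" "\<forall>x\<in>\<psi> ` V'. \<exists>b\<in>B. x - b \<in> \<psi> ` V"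
    using fin unfolding finite_index_def by blast
  obtain B' where B': "B' \<subseteq> V'" "finite B'" "B = \<psi> ` B'" using finite_subset_image[OF B(2,1)] by blast
  note VD = vec_subgroupD[OF V] and VD' = vec_subgroupD[OF V']
  show ?thesis unfolding finite_index_def
  proof (intro exI conjI ballI)
    show "(\<lambda>(a, b). a + b) ` (A \<times> B') \<subseteq> V'" using A(1) B'(1) VD'(4) by auto
    show "finite ((\<lambda>(a, b). a + b) ` (A \<times> B'))" using A(2) B'(2) by simp
    fix x assume x: "x \<in> V'"
    then obtain b v where b: "b \<in> B'" "v \<in> V" "\<psi> x - \<psi> b = \<psi> v" using B(3) B'(3) by blast
    have c: "x \<in> carrier_vec n" "b \<in> carrier_vec n" "v \<in> carrier_vec n"
      using x b B'(1) VD(1) VD'(1) by auto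
    then have "\<psi> (x - b - v) = \<psi> v - \<psi> v" using b(3) by (simp add: diff)
    also have "\<dots> = 0\<^sub>v m" using range[OF c(3)] by simp
    finally have "x - b - v \<in> K" using c by (simp add: K)
    moreover have "x - b - v \<in> V'" using x b B'(1) sub by (intro VD'(3)) auto
    ultimately obtain a where a: "a \<in> A" "x - b - v - a \<in> V" using A(3) by blast
    then have ac: "a \<in> carrier_vec n" using A(1) VD'(1) by blast
    have "x - (a + b) = (x - b - v - a) + v" using c ac by (intro eq_vecI) auto
    then have "x - (a + b) \<in> V" using VD(4)[OF a(2) b(2)] by simp
    then show "\<exists>c\<in>(\<lambda>(a, b). a + b) ` (A \<times> B'). x - c \<in> V" using a b by force
  qed
qed

text \<open>Representatives are pushed forward; each element of \<open>W'\<close> has a preimage in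
  \<open>F\<close> because \<open>W'\<close> lies in the image.\<close>

lemma finite_index_if_vimage:
  assumes F: "F \<subseteq> carrier_vec n"
    and diff: "\<And>x y. x \<in> carrier_vec n \<Longrightarrow> y \<in> carrier_vec n \<Longrightarrow> \<psi> (x - y) = \<psi> x - \<psi> y"
    and W': "W' \<subseteq> \<psi> ` F" and "finite_index {x \<in> F. \<psi> x \<in> W} {x \<in> F. \<psi> x \<in> W'}"
  shows "finite_index W W'"
proof -
  obtain A where A: "A \<subseteq> {x \<in> F. \<psi> x \<in> W'}" "finite A"
      "\<forall>x\<in>{x \<in> F. \<psi> x \<in> W'}. \<exists>a\<in>A. x - a \<in> {x \<in> F. \<psi> x \<in> W}"
    using assms(4) unfolding finite_index_def by blast
  show ?thesis unfolding finite_index_def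
  proof (intro exI conjI ballI)
    show "\<psi> ` A \<subseteq> W'" "finite (\<psi> ` A)" using A by auto
    fix w assume w: "w \<in> W'"
    then obtain x where x: "x \<in> F" "w = \<psi> x" using W' by blast
    then obtain a where a: "a \<in> A" "\<psi> (x - a) \<in> W" using A(3) w by blast
    then have "\<psi> (x - a) = w - \<psi> a" using x F A(1) diff by blast
    then show "\<exists>b\<in>\<psi> ` A. w - b \<in> W" using a by auto
  qed
qed

subsection \<open>Chains of infinite index and the dimension\<close>

text \<open>A chain with top \<open>F\<close> and \<open>l\<close> steps of infinite index.
  Irreducibility is dropped because intersections with a kernel and preimages need not be
  irreducible.\<close>

primrec index_chain :: "nat \<Rightarrow> nat \<Rightarrow> nat \<Rightarrow> 'a::comm_ring_1 vec set \<Rightarrow> bool" where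
  "index_chain q n 0 F \<longleftrightarrow> q_variety q n F"
| "index_chain q n (Suc l) F \<longleftrightarrow>
     q_variety q n F \<and> (\<exists>G. index_chain q n l G \<and> G \<subseteq> F \<and> \<not> finite_index G F)"

lemma index_chain_imp_q_variety: "index_chain q n l F \<Longrightarrow> q_variety q n F"
  by (cases l) auto

context frobenius_power
begin

lemma q_irreducible_iff:
  "q_irreducible q n (F :: 'a vec set) \<longleftrightarrow>
     q_variety q n F \<and> (\<forall>G. q_variety q n G \<longrightarrow> G \<subseteq> F \<longrightarrow> finite_index G F \<longrightarrow> G = F)"
  using finite_index_iff_rcosets[OF q_variety_imp_vec_subgroup q_variety_imp_vec_subgroup]
  unfolding q_irreducible_def by (metis psubset_eq)

text \<open>A variety that is not irreducible has a proper subvariety of finite index. Descent along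
  such subvarieties terminates, and finite index is transitive.\<close>

lemma ex_irreducible_finite_index:
  assumes "q_variety q n (F :: 'a vec set)"
  shows "\<exists>G\<subseteq>F. q_irreducible q n G \<and> finite_index G F"
  using assms
proof (induction F rule: wf_induct_rule[OF wf_q_variety_psubset[of n]])
  case (1 F)
  note F = \<open>q_variety q n F\<close>
  show ?case
  proof (cases "q_irreducible q n F")
    case True
    then show ?thesis using finite_index_refl[OF q_variety_imp_vec_subgroup[OF F]] by blast
  next
    case False
    then obtain E where E: "q_variety q n E" "E \<subset> F" "finite_index E F"
      using F by (auto simp: q_irreducible_iff)
    then obtain G where G: "G \<subseteq> E" "q_irreducible q n G" "finite_index G E"
      using 1(1)[of E] F by auto
    have "vec_subgroup n G" "vec_subgroup n F"
      using G F by (auto simp: q_irreducible_iff q_variety_imp_vec_subgroup)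
    then have "finite_index G F" using finite_index_trans E G by blast
    then show ?thesis using E G by blast
  qed
qed

text \<open>Only the top is enlarged: if \<open>E\<close> had finite index in \<open>G\<close>,
  restriction to \<open>F\<close> would give it finite index in \<open>F\<close>.\<close>

lemma index_chain_mono:
  assumes "index_chain q n l (F :: 'a vec set)" "F \<subseteq> G" "q_variety q n G"
  shows "index_chain q n l G"
proof (cases l)
  case 0
  then show ?thesis using assms by simp
next
  case (Suc k)
  then obtain E where E: "index_chain q n k E" "E \<subseteq> F" "\<not> finite_index E F" using assms by auto
  have "vec_subgroup n E" "vec_subgroup n F" "vec_subgroup n G"
    using E(1) assms index_chain_imp_q_variety q_variety_imp_vec_subgroup by blast+
  then have "\<not> finite_index E G"
    using finite_index_restrict[of n E G F] E(2,3) assms(2) by (metis Int_absorb2)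
  then show ?thesis using Suc E assms by auto
qed

text \<open>Strict inclusions into an irreducible variety have infinite index. Conversely, each
  member of an index chain can be replaced by an irreducible subvariety of finite index.\<close>

lemma q_dim_eq_index_chain: "q_dim q n (F :: 'a vec set) = Sup {enat l | l. index_chain q n l F}"
  if F: "q_variety q n F"
proof -
  have chain_imp: "index_chain q n l F"
    if C: "\<forall>i\<le>l. q_irreducible q n (C i) \<and> C i \<subseteq> F" "\<forall>i<l. C i \<subset> C (Suc i)" for l and C :: "nat \<Rightarrow> 'a vec set"
  proof -
    have "index_chain q n i (C i)" if "i \<le> l" for i
      using that
    proof (induction i)
      case 0
      then show ?case using C by (simp add: q_irreducible_iff)
    next
      case (Suc i)
      then have "q_irreducible q n (C (Suc i))" "q_variety q n (C i)" "C i \<subset> C (Suc i)"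
        using C by (auto simp: q_irreducible_iff)
      then have "\<not> finite_index (C i) (C (Suc i))" "q_variety q n (C (Suc i))"
        unfolding q_irreducible_iff by blast+
      then show ?case using Suc \<open>C i \<subset> C (Suc i)\<close> by auto
    qed
    then show ?thesis using index_chain_mono[of n l "C l" F] C F by blast
  qed
  \<comment> \<open>The finite index of \<open>C l\<close> in \<open>F\<close> is carried along
    because the next step needs it to keep the new top distinct from \<open>C l\<close>.\<close>
  have imp_chain: "\<exists>C. (\<forall>i\<le>l. q_irreducible q n (C i)) \<and> (\<forall>i<l. C i \<subset> C (Suc i)) \<and>
      C l \<subseteq> F \<and> finite_index (C l) F" if "index_chain q n l F" for l and F :: "'a vec set"
    using that
  proof (induction l arbitrary: F)
    case 0
    then have "q_variety q n F" by simp
    then obtain G where "G \<subseteq> F" "q_irreducible q n G" "finite_index G F"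
      using ex_irreducible_finite_index by blast
    then show ?case by (intro exI[of _ "\<lambda>_. G"]) auto
  next
    case (Suc l)
    then obtain G where G: "index_chain q n l G" "G \<subseteq> F" "\<not> finite_index G F" by auto
    obtain C where C: "\<forall>i\<le>l. q_irreducible q n (C i)" "\<forall>i<l. C i \<subset> C (Suc i)"
      "C l \<subseteq> G" "finite_index (C l) G" using Suc.IH[OF G(1)] by blast
    have F: "q_variety q n F" using Suc.prems by simp
    obtain E where E: "E \<subseteq> F" "q_irreducible q n E" "finite_index E F"
      using ex_irreducible_finite_index[OF F] by blast
    have var: "q_variety q n (C l)" "q_variety q n E"
      using C(1) E(2) by (auto simp: q_irreducible_iff)
    \<comment> \<open>A subvariety of finite index in the irreducible \<open>C l\<close> is all of
      \<open>C l\<close>, which puts \<open>C l\<close> inside \<open>E\<close>.\<close>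
    have "finite_index (E \<inter> C l) (C l)"
      by (rule finite_index_restrict[of n _ F]) (use var F C(3) G(2) E in \<open>auto simp: q_variety_imp_vec_subgroup\<close>)
    moreover have "q_irreducible q n (C l)" using C(1) by simp
    ultimately have "E \<inter> C l = C l" using q_variety_inter[OF var(2,1)] unfolding q_irreducible_iff by blast
    \<comment> \<open>Otherwise \<open>G\<close> would contain a subvariety of finite index in
      \<open>F\<close>, against the choice of \<open>G\<close>.\<close>
    moreover have "E \<noteq> C l" using E(3) C(3) G(3) finite_index_mono by blast
    ultimately have "C l \<subset> E" by blast
    then show ?case using C E
      by (intro exI[of _ "C(Suc l := E)"]) (auto simp: le_Suc_eq less_Suc_eq)
  qed
  have mono: "C i \<subseteq> C l" if "\<forall>i<l. C i \<subset> C (Suc i)" "i \<le> l" for i l and C :: "nat \<Rightarrow> 'a vec set"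
    using that(2,1) by (induction l rule: dec_induct) auto
  have "(\<exists>C. (\<forall>i\<le>l. q_irreducible q n (C i) \<and> C i \<subseteq> F) \<and> (\<forall>i<l. C i \<subset> C (Suc i))) \<longleftrightarrow>
      index_chain q n l F" for l
  proof
    assume "index_chain q n l F"
    from imp_chain[OF this] obtain C where "\<forall>i\<le>l. q_irreducible q n (C i)"
      "\<forall>i<l. C i \<subset> C (Suc i)" "C l \<subseteq> F" by blast
    then show "\<exists>C. (\<forall>i\<le>l. q_irreducible q n (C i) \<and> C i \<subseteq> F) \<and> (\<forall>i<l. C i \<subset> C (Suc i))"
      using mono[of l C] by (intro exI[of _ C]) blast
  qed (use chain_imp in blast)
  then show ?thesis unfolding q_dim_def by simp
qed

end

section \<open>Additivity of the dimension\<close>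

text \<open>Finite suprema are attained and can be added; if one set is unbounded, both sides are
  infinite. Nonemptiness matters because the supremum of the empty set is 0.\<close>

lemma Sup_enat_add:
  fixes S T :: "nat \<Rightarrow> bool"
  assumes "\<exists>a. S a" "\<exists>b. T b"
  shows "Sup {enat (a + b) | a b. S a \<and> T b} = Sup {enat a | a. S a} + Sup {enat b | b. T b}"
    (is "Sup ?ST = Sup ?S + Sup ?T")
proof (rule antisym)
  show "Sup ?ST \<le> Sup ?S + Sup ?T"
  proof (rule Sup_least)
    fix x assume "x \<in> ?ST"
    then obtain a b where x: "x = enat a + enat b" and ab: "S a" "T b" by auto
    show "x \<le> Sup ?S + Sup ?T" unfolding x by (intro add_mono Sup_upper) (use ab in auto)
  qed
  have attained: "Sup A \<in> A" if "A \<noteq> {}" "finite A" for A :: "enat set"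
    using that by (simp add: Sup_enat_def)
  have infinite: "Sup A = \<infinity>" if "infinite A" for A :: "enat set"
    using that by (auto simp: Sup_enat_def)
  have ne: "?S \<noteq> {}" "?T \<noteq> {}" using assms by auto
  obtain a0 b0 where a0: "S a0" and b0: "T b0" using assms by blast
  consider "finite ?S" "finite ?T" | "infinite ?S" | "infinite ?T" by blast
  then show "Sup ?S + Sup ?T \<le> Sup ?ST"
  proof cases
    case 1
    obtain a where a: "Sup ?S = enat a" "S a" using attained[OF ne(1) 1(1)] by blast
    obtain b where b: "Sup ?T = enat b" "T b" using attained[OF ne(2) 1(2)] by blast
    show ?thesis unfolding a(1) b(1) by (rule Sup_upper) (use a(2) b(2) in auto)
  next
    case 2
    \<comment> \<open>Adding a finite number is injective on \<open>enat\<close>, so a shifted copy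
      of the infinite set lies in \<open>?ST\<close>.\<close>
    have "(\<lambda>x. x + enat b0) ` ?S \<subseteq> ?ST" using b0 by force
    moreover have "infinite ((\<lambda>x. x + enat b0) ` ?S)" using 2 by (subst finite_image_iff) (auto simp: inj_on_def)
    ultimately have "infinite ?ST" by (rule infinite_super)
    then show ?thesis by (simp only: infinite not_False_eq_True enat_ord_simps)
  next
    case 3
    have "(\<lambda>x. enat a0 + x) ` ?T \<subseteq> ?ST" using a0 by force
    moreover have "infinite ((\<lambda>x. enat a0 + x) ` ?T)" using 3 by (subst finite_image_iff) (auto simp: inj_on_def)
    ultimately have "infinite ?ST" by (rule infinite_super)
    then show ?thesis by (simp only: infinite not_False_eq_True enat_ord_simps)
  qed
qed

context frobenius_power
begin

text \<open>The chain lengths of \<open>F\<close> are exactly the sums of a chain length of the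
  kernel and one of the image; then suprema are taken.\<close>

lemma q_dim_kernel_image:
  fixes F :: "'a vec set"
  assumes F: "q_variety q n F" and f: "\<And>j. j < m \<Longrightarrow> lam n (f j)"
  defines "\<psi> \<equiv> \<lambda>x. vec m (\<lambda>j. f j x)"
  shows "q_dim q n F = q_dim q n {x \<in> F. \<psi> x = 0\<^sub>v m} + q_dim q m (\<psi> ` F)"
proof -
  define K where "K = {x \<in> carrier_vec n. \<psi> x = 0\<^sub>v m}"
  have \<psi>_diff: "\<psi> (x - y) = \<psi> x - \<psi> y" if "x \<in> carrier_vec n" "y \<in> carrier_vec n" for x y
    using that lam_apply_diff[OF f] by (intro eq_vecI) (auto simp: \<psi>_def)
  have \<psi>_carrier: "\<psi> x \<in> carrier_vec m" for x by (simp add: \<psi>_def)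
  have image: "q_variety q m (\<psi> ` G)" if "q_variety q n G" for G
    unfolding \<psi>_def using q_variety_image that f by blast
  have vimage: "q_variety q n {x \<in> F. \<psi> x \<in> W}" if "q_variety q m W" for W
  proof -
    have "q_variety q n (F \<inter> {x \<in> carrier_vec n. \<psi> x \<in> W})"
      unfolding \<psi>_def by (intro q_variety_inter F q_variety_vimage that f)
    moreover have "F \<inter> {x \<in> carrier_vec n. \<psi> x \<in> W} = {x \<in> F. \<psi> x \<in> W}"
      using vec_subgroupD(1)[OF q_variety_imp_vec_subgroup[OF F]] by blast
    ultimately show ?thesis by simp
  qed
  have K: "q_variety q n K"
    unfolding K_def \<psi>_def using q_variety_vimage[OF q_variety_singleton_0[of m] f] by simp
  have FK: "F \<inter> K = {x \<in> F. \<psi> x = 0\<^sub>v m}"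
    using vec_subgroupD(1)[OF q_variety_imp_vec_subgroup[OF F]] by (auto simp: K_def)
  \<comment> \<open>At each step of infinite index the kernel part or the image part has infinite
    index too. One such part is lengthened, the other carried up by \<open>index_chain_mono\<close>,
    so the lengths add up to exactly \<open>l\<close>.\<close>
  have split: "\<exists>a b. l = a + b \<and> index_chain q n a (G \<inter> K) \<and> index_chain q m b (\<psi> ` G)"
    if "index_chain q n l G" for l G
    using that
  proof (induction l arbitrary: G)
    case 0
    then show ?case using q_variety_inter K image by auto
  next
    case (Suc l)
    then obtain E where E: "index_chain q n l E" "E \<subseteq> G" "\<not> finite_index E G"
      and G: "q_variety q n G" by auto
    obtain a b where ab: "l = a + b" "index_chain q n a (E \<inter> K)" "index_chain q m b (\<psi> ` E)"
      using Suc.IH[OF E(1)] by blast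
    have "vec_subgroup n E" "vec_subgroup n G"
      using G E(1) index_chain_imp_q_variety q_variety_imp_vec_subgroup by blast+
    then have "\<not> (finite_index (E \<inter> K) (G \<inter> K) \<and> finite_index (\<psi> ` E) (\<psi> ` G))"
      using finite_index_if_kernel_image[of n E G \<psi> m K] E(2,3) \<psi>_diff \<psi>_carrier K_def by blast
    then consider "\<not> finite_index (E \<inter> K) (G \<inter> K)" | "\<not> finite_index (\<psi> ` E) (\<psi> ` G)" by blast
    then show ?case
    proof cases
      case 1
      then have "index_chain q n (Suc a) (G \<inter> K)" using ab(2) E(2) q_variety_inter[OF G K] by auto
      moreover have "index_chain q m b (\<psi> ` G)"
        using index_chain_mono[OF ab(3) image_mono[OF E(2)] image[OF G]] .
      ultimately show ?thesis using ab(1) by (intro exI[of _ "Suc a"] exI[of _ b]) simp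
    next
      case 2
      then have "index_chain q m (Suc b) (\<psi> ` G)" using ab(3) E(2) image[OF G] by auto
      moreover have "index_chain q n a (G \<inter> K)"
        using index_chain_mono[OF ab(2) _ q_variety_inter[OF G K]] E(2) by blast
      ultimately show ?thesis using ab(1) by (intro exI[of _ a] exI[of _ "Suc b"]) simp
    qed
  qed
  \<comment> \<open>The kernel chain forms the bottom, and preimages of the chain in the image are
    stacked on it.\<close>
  have join: "index_chain q n (a + b) {x \<in> F. \<psi> x \<in> W}"
    if "index_chain q n a (F \<inter> K)" "index_chain q m b W" "W \<subseteq> \<psi> ` F" for a b W
    using that(2,3)
  proof (induction b arbitrary: W)
    case 0
    \<comment> \<open>As \<open>W\<close> contains 0, its preimage contains the kernel, so the
      kernel chain can be given this preimage as its top.\<close>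
    then have "0\<^sub>v m \<in> W" using vec_subgroupD(2)[OF q_variety_imp_vec_subgroup[of m W]] by simp
    then have "F \<inter> K \<subseteq> {x \<in> F. \<psi> x \<in> W}" unfolding FK by auto
    then show ?case using index_chain_mono[OF that(1) _ vimage[of W]] 0 by simp
  next
    case (Suc b)
    then obtain W' where W': "index_chain q m b W'" "W' \<subseteq> W" "\<not> finite_index W' W"
      and W: "q_variety q m W" by auto
    have "index_chain q n (a + b) {x \<in> F. \<psi> x \<in> W'}" using Suc.IH W' Suc.prems(2) by blast
    moreover have "\<not> finite_index {x \<in> F. \<psi> x \<in> W'} {x \<in> F. \<psi> x \<in> W}"
      using finite_index_if_vimage[of F n \<psi> W W'] \<psi>_diff Suc.prems(2) W'(3)
        vec_subgroupD(1)[OF q_variety_imp_vec_subgroup[OF F]] by blast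
    moreover have "{x \<in> F. \<psi> x \<in> W'} \<subseteq> {x \<in> F. \<psi> x \<in> W}" using W'(2) by blast
    ultimately show ?case using vimage[OF W] by auto
  qed
  have "index_chain q n l F \<longleftrightarrow>
      (\<exists>a b. l = a + b \<and> index_chain q n a (F \<inter> K) \<and> index_chain q m b (\<psi> ` F))" for l
  proof
    assume "\<exists>a b. l = a + b \<and> index_chain q n a (F \<inter> K) \<and> index_chain q m b (\<psi> ` F)"
    \<comment> \<open>Taking the whole image for \<open>W\<close> makes the top of the joined chain
      \<open>F\<close> itself.\<close>
    moreover have "{x \<in> F. \<psi> x \<in> \<psi> ` F} = F" by blast
    ultimately show "index_chain q n l F" using join[of _ _ "\<psi> ` F"] by auto
  qed (rule split)
  then have "{enat l | l. index_chain q n l F} =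
      {enat (a + b) | a b. index_chain q n a (F \<inter> K) \<and> index_chain q m b (\<psi> ` F)}" by blast
  moreover have "\<exists>a. index_chain q n a (F \<inter> K)" "\<exists>b. index_chain q m b (\<psi> ` F)"
    using q_variety_inter[OF F K] image[OF F] index_chain.simps(1) by blast+
  ultimately show ?thesis
    using q_dim_eq_index_chain[OF F] q_dim_eq_index_chain[OF q_variety_inter[OF F K]]
      q_dim_eq_index_chain[OF image[OF F]] Sup_enat_add
    by (simp only: FK)
qed

end

theorem theorem4p10:
  fixes F H :: "'a::alg_closed_field vec set"
    and \<psi> :: "'a vec \<Rightarrow> 'a vec"
    and p q e n m :: nat
  assumes "prime p" and "CHAR('a) = p"
    and "e \<ge> 1" and "q = p ^ e"
    and "q_variety q n F" and "q_variety q m H"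
    and "q_morphism q n F m H \<psi>"
  shows "q_dim q n F =
           q_dim q n (kernel (add_grp n F) (add_grp m H) \<psi>) + q_dim q m (\<psi> ` F)"
proof -
  interpret frobenius_power q e "TYPE('a)"
    using assms by unfold_locales simp_all
  obtain f where f: "\<forall>j<m. f j \<in> Lambda q n" "\<forall>x\<in>F. \<psi> x = vec m (\<lambda>j. eval_Lambda (f j) x)"
    using assms(7) unfolding q_morphism_def by blast
  have "lam n (eval_Lambda (f j))" if "j < m" for j
    using f(1) that by (auto simp: lam_iff_Lambda)
  note dim = q_dim_kernel_image[OF assms(5) this, of m]
  \<comment> \<open>\<open>\<psi>\<close> is known to be polynomial only on \<open>F\<close>, so
    kernel and image are rewritten with the polynomial map; the unit of \<open>add_grp m H\<close>
    is the zero vector.\<close>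
  have "kernel (add_grp n F) (add_grp m H) \<psi> = {x \<in> F. vec m (\<lambda>j. eval_Lambda (f j) x) = 0\<^sub>v m}"
    using f(2) by (auto simp: kernel_def add_grp_def monoid_vec_def)
  moreover have "\<psi> ` F = (\<lambda>x. vec m (\<lambda>j. eval_Lambda (f j) x)) ` F" using f(2) by simp
  ultimately show ?thesis using dim by simp
qed

end
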